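(* Let $\lambda = (\lambda_1, \lambda_2, \dots, \lambda_k)$ be a partition. Then the power sum symmetric function $p_\lambda$ satisfies $$p_\lambda = X_{\overline{K_{\lambda_1}}}^{K_1} X_{\overline{K_{\lambda_2}}}^{K_1} \cdots X_{\overline{K_{\lambda_k}}}^{K_1} .$$
   Context: All graphs are finite, simple, undirected, with at least one vertex. $K_n$ is the complete graph on $n$ vertices and $\overline{K_n}$ is the edgeless graph on $n$ vertices. $p_n=m_{(n)}=\sum_i x_i^n$ and $p_\lambda=p_{\lambda_1}p_{\lambda_2}\cdots p_{\lambda_k}$, where $m_\lambda$ denotes the monomial symmetric function. $H$-chromatic symmetric function: let $G,H$ be graphs with $|V(G)|=k$, $|V(H)|=N$. A labeling of $H$ is a bijection $\phi:V(H)\to[N]$. A proper $(H,\phi)$-coloring of $G$ is a map $\kappa:V(G)\to[N]$ such that whenever $u,v$ are adjacent in $G$, $\phi^{-1}(\kappa(u))$ and $\phi^{-1}(\kappa(v))$ are adjacent in $H$. Put $w_G^H=\sum_\phi\sum_\kappa\prod_{v\in V(G)}x_{\kappa(v)}$, summed over all labelings $\phi$ and all proper $(H,\phi)$-colorings $\kappa$. This is a symmetric polynomial in $x_1,\dots,x_N$, homogeneous of degree $k$; writing $w_G^H=\sum_{\lambda\vdash k,\,l(\lambda)\le N}c_\lambda m_\lambda(x_1,\dots,x_N)$ (with $l(\lambda)$ the number of parts), define $X_G^H=\sum_{\lambda\vdash k,\,l(\lambda)\le N}c_\lambda m_\lambda\in\Lambda^k$. *)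

theory Defs
  imports
    "HOL-Library.Multiset"
    "HOL-Library.FuncSet"
    "HOL-Combinatorics.Permutations"
    "Graph_Theory.Kuratowski"
begin

section \<open>Formal power series in countably many variables\<close>

text \<open>
  A monomial is encoded as the multiset of the indices of its variables, so that the exponent of
  the variable with index \<open>i\<close> in \<open>M\<close> is \<open>count M i\<close> and the product of monomials is the sum of
  multisets. Indices start at 0: the variable usually called $x_i$ is \<open>var (i - 1)\<close>, and
  the set $[N]$ is rendered as \<open>{..<N}\<close>. The polynomial ring in the first \<open>N\<close> variables and the ring
  of symmetric functions are both contained in this ring.
\<close>

typedef 'a mps = "UNIV :: (nat multiset \<Rightarrow> 'a) set"
  morphisms coeff Abs_mps ..

setup_lifting type_definition_mps

lemma mps_eqI: "(\<And>M. coeff f M = coeff g M) \<Longrightarrow> f = g"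
  by transfer auto

lemma finite_submultisets: "finite {A. A \<subseteq># (M :: 'b multiset)}"
proof -
  have "{A. A \<subseteq># M} \<subseteq> {A. set_mset A \<subseteq> set_mset M \<and> size A \<le> size M}"
    by (auto dest: set_mset_mono size_mset_mono)
  moreover have "{A. set_mset A \<subseteq> set_mset M \<and> size A \<le> size M}
      \<subseteq> mset ` {xs. set xs \<subseteq> set_mset M \<and> length xs \<le> size M}"
  proof
    fix A assume "A \<in> {A. set_mset A \<subseteq> set_mset M \<and> size A \<le> size M}"
    moreover obtain xs where "mset xs = A" using ex_mset by blast
    ultimately show "A \<in> mset ` {xs. set xs \<subseteq> set_mset M \<and> length xs \<le> size M}" by auto
  qed
  ultimately show ?thesis
    using finite_lists_length_le[OF finite_set_mset, of M "size M"] finite_subset finite_imageI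
    by (metis (no_types, lifting))
qed

lemma double_diff_mset: "A \<subseteq># M \<Longrightarrow> M - (M - A) = A"
  by (rule multiset_eqI) (simp add: subseteq_mset_def)

instantiation mps :: (comm_ring_1) comm_ring_1
begin

lift_definition zero_mps :: "'a mps" is "\<lambda>_. 0" .
lift_definition one_mps :: "'a mps" is "\<lambda>M. if M = {#} then 1 else 0" .
lift_definition plus_mps :: "'a mps \<Rightarrow> 'a mps \<Rightarrow> 'a mps" is "\<lambda>f g M. f M + g M" .
lift_definition minus_mps :: "'a mps \<Rightarrow> 'a mps \<Rightarrow> 'a mps" is "\<lambda>f g M. f M - g M" .
lift_definition uminus_mps :: "'a mps \<Rightarrow> 'a mps" is "\<lambda>f M. - f M" .
lift_definition times_mps :: "'a mps \<Rightarrow> 'a mps \<Rightarrow> 'a mps"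
  is "\<lambda>f g M. \<Sum>A | A \<subseteq># M. f A * g (M - A)" .

instance
proof
  fix f g h :: "'a mps"
  show "f * g * h = f * (g * h)"
  proof (rule mps_eqI)
    fix M :: "nat multiset"
    let ?I = "{A. A \<subseteq># M}"
    have "coeff (f * g * h) M =
        (\<Sum>B\<in>?I. \<Sum>A | A \<subseteq># B. coeff f A * coeff g (B - A) * coeff h (M - B))"
      by (simp add: times_mps.rep_eq sum_distrib_right)
    also have "\<dots> = (\<Sum>(B, A)\<in>Sigma ?I (\<lambda>B. {A. A \<subseteq># B}).
        coeff f A * coeff g (B - A) * coeff h (M - B))"
      by (rule sum.Sigma) (auto simp: finite_submultisets)
    also have "\<dots> = (\<Sum>(A, C)\<in>Sigma ?I (\<lambda>A. {C. C \<subseteq># M - A}).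
        coeff f A * (coeff g C * coeff h (M - A - C)))"
    proof (rule sum.reindex_bij_witness[where j = "\<lambda>(B, A). (A, B - A)"
          and i = "\<lambda>(A, C). (A + C, A)"], goal_cases)
      case (1 a)
      then show ?case by (auto simp: subset_mset.add_diff_inverse)
    next
      case (2 a)
      then show ?case by (auto simp: subseteq_mset_def intro: order_trans intro!: diff_le_mono)
    next
      case (3 b)
      then show ?case by auto
    next
      case (4 b)
      then show ?case by (auto simp: subseteq_mset_def Nat.le_diff_conv2 add.commute)
    next
      case (5 a)
      then show ?case by (auto simp: subset_mset.add_diff_inverse mult.assoc diff_diff_add_mset)
    qed
    also have "\<dots> = (\<Sum>A\<in>?I. \<Sum>C | C \<subseteq># M - A. coeff f A * (coeff g C * coeff h (M - A - C)))"
      by (rule sum.Sigma[symmetric]) (auto simp: finite_submultisets)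
    also have "\<dots> = coeff (f * (g * h)) M"
      by (simp add: times_mps.rep_eq sum_distrib_left)
    finally show "coeff (f * g * h) M = coeff (f * (g * h)) M" .
  qed
  show "f * g = g * f"
  proof (rule mps_eqI)
    fix M :: "nat multiset"
    show "coeff (f * g) M = coeff (g * f) M"
      unfolding times_mps.rep_eq
      by (rule sum.reindex_bij_witness[where j = "\<lambda>A. M - A" and i = "\<lambda>A. M - A"])
        (auto simp: mult.commute diff_subset_eq_self double_diff_mset)
  qed
  show "1 * f = f"
  proof (rule mps_eqI)
    fix M :: "nat multiset"
    have "coeff (1 * f) M = (\<Sum>A | A \<subseteq># M. if A = {#} then coeff f M else 0)"
      unfolding times_mps.rep_eq one_mps.rep_eq by (rule sum.cong) auto
    also have "\<dots> = coeff f M"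
      using finite_submultisets[of M] by (simp add: sum.delta)
    finally show "coeff (1 * f) M = coeff f M" .
  qed
  show "(f + g) * h = f * h + g * h"
    by (rule mps_eqI) (simp add: times_mps.rep_eq plus_mps.rep_eq distrib_right sum.distrib)
  show "(0 :: 'a mps) \<noteq> 1"
    by transfer (metis zero_neq_one)
qed (transfer; auto simp: algebra_simps)+

end

lift_definition const :: "'a \<Rightarrow> 'a::comm_ring_1 mps" is "\<lambda>c M. if M = {#} then c else 0" .

lift_definition monomial :: "nat multiset \<Rightarrow> 'a::comm_ring_1 mps"
  is "\<lambda>A M. if M = A then 1 else 0" .

definition var :: "nat \<Rightarrow> 'a::comm_ring_1 mps" where
  "var i = monomial {#i#}"

lemma coeff_sum: "coeff (\<Sum>i\<in>I. f i) M = (\<Sum>i\<in>I. coeff (f i :: 'a::comm_ring_1 mps) M)"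
  by (induction I rule: infinite_finite_induct) (auto simp: zero_mps.rep_eq plus_mps.rep_eq)

lemma coeff_const_mult: "coeff (const c * f) M = c * coeff f M"
proof -
  have "coeff (const c * f) M = (\<Sum>A | A \<subseteq># M. if A = {#} then c * coeff f M else 0)"
    unfolding times_mps.rep_eq const.rep_eq by (rule sum.cong) auto
  also have "\<dots> = c * coeff f M"
    using finite_submultisets[of M] by (simp add: sum.delta)
  finally show ?thesis .
qed

lemma monomial_mult: "monomial A * monomial B = (monomial (A + B) :: 'a::comm_ring_1 mps)"
proof (rule mps_eqI)
  fix M
  have "coeff (monomial A * monomial B :: 'a mps) M =
      (\<Sum>C | C \<subseteq># M. if C = A then (if M - A = B then 1 else 0) else 0)"
    unfolding times_mps.rep_eq monomial.rep_eq by (rule sum.cong) auto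
  also have "\<dots> = (if A \<subseteq># M \<and> M - A = B then 1 else 0)"
    using finite_submultisets[of M] by (simp add: sum.delta)
  also have "\<dots> = coeff (monomial (A + B)) M"
    by (auto simp: monomial.rep_eq)
  finally show "coeff (monomial A * monomial B :: 'a mps) M = coeff (monomial (A + B)) M" .
qed

lemma prod_var:
  "finite V \<Longrightarrow> (\<Prod>v\<in>V. var (k v)) = (monomial (image_mset k (mset_set V)) :: 'a::comm_ring_1 mps)"
proof (induction V rule: finite_induct)
  case empty
  show ?case by (rule mps_eqI) (simp add: one_mps.rep_eq monomial.rep_eq)
qed (simp add: var_def monomial_mult)


section \<open>Partitions and symmetric functions\<close>

definition int_partition :: "nat list \<Rightarrow> bool" where
  "int_partition lam \<longleftrightarrow> sorted_wrt (\<ge>) lam \<and> (\<forall>a\<in>set lam. 0 < a)"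

definition exponents :: "nat multiset \<Rightarrow> nat multiset" where
  "exponents M = image_mset (count M) (mset_set (set_mset M))"

text \<open>
  \<open>monomial_sym V lam\<close> is $m_\lambda$ in the variables with indices in \<open>V\<close>: the sum of all distinct
  monomials in these variables whose nonzero exponents are a rearrangement of \<open>lam\<close>.
\<close>

lift_definition monomial_sym :: "nat set \<Rightarrow> nat list \<Rightarrow> 'a::comm_ring_1 mps"
  is "\<lambda>V lam M. if set_mset M \<subseteq> V \<and> exponents M = mset lam then 1 else 0" .

abbreviation msym :: "nat list \<Rightarrow> 'a::comm_ring_1 mps" where
  "msym lam \<equiv> monomial_sym UNIV lam"

definition power_sum :: "nat \<Rightarrow> 'a::comm_ring_1 mps" where
  "power_sum n = msym [n]"

lemma coeff_power_sum:
  assumes "0 < n"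
  shows "coeff (power_sum n) M = (if \<exists>i. M = replicate_mset n i then 1 else 0)"
proof -
  have "exponents M = {#n#} \<longleftrightarrow> (\<exists>i. M = replicate_mset n i)"
  proof
    assume *: "exponents M = {#n#}"
    then have "card (set_mset M) = 1"
      by (metis exponents_def size_image_mset size_mset_set size_single)
    then obtain i where i: "set_mset M = {i}"
      using card_1_singletonE by blast
    with * have "count M i = n" by (simp add: exponents_def)
    with i show "\<exists>i. M = replicate_mset n i"
      by (metis set_mset_subset_singletonD subset_refl count_replicate_mset)
  qed (use assms in \<open>auto simp: exponents_def\<close>)
  then show ?thesis by (simp add: power_sum_def monomial_sym.rep_eq)
qed

definition power_sum_partition :: "nat list \<Rightarrow> 'a::comm_ring_1 mps" where
  "power_sum_partition lam = (\<Prod>i<length lam. power_sum (lam ! i))"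


section \<open>The H-chromatic symmetric function\<close>

definition labelings :: "('b, 'd) pre_digraph \<Rightarrow> ('b \<Rightarrow> nat) set" where
  "labelings H = {\<phi> \<in> verts H \<rightarrow>\<^sub>E {..<card (verts H)}. bij_betw \<phi> (verts H) {..<card (verts H)}}"

definition proper_colorings ::
    "('a, 'c) pre_digraph \<Rightarrow> ('b, 'd) pre_digraph \<Rightarrow> ('b \<Rightarrow> nat) \<Rightarrow> ('a \<Rightarrow> nat) set" where
  "proper_colorings G H \<phi> = {\<kappa> \<in> verts G \<rightarrow>\<^sub>E {..<card (verts H)}.
     \<forall>u v. u \<rightarrow>\<^bsub>G\<^esub> v \<longrightarrow> inv_into (verts H) \<phi> (\<kappa> u) \<rightarrow>\<^bsub>H\<^esub> inv_into (verts H) \<phi> (\<kappa> v)}"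

definition hchrom_poly ::
    "('a, 'c) pre_digraph \<Rightarrow> ('b, 'd) pre_digraph \<Rightarrow> 'r::comm_ring_1 mps" where
  "hchrom_poly G H = (\<Sum>\<phi>\<in>labelings H. \<Sum>\<kappa>\<in>proper_colorings G H \<phi>. \<Prod>v\<in>verts G. var (\<kappa> v))"

definition partitions_of :: "nat \<Rightarrow> nat \<Rightarrow> nat list set" where
  "partitions_of k N = {lam. int_partition lam \<and> sum_list lam = k \<and> length lam \<le> N}"

text \<open>
  \<open>hchrom G H\<close> is $X_G^H$. That the description determines a unique element
  is shown in \<open>hchrom_expansion_ex1\<close> below.
\<close>

definition hchrom ::
    "('a, 'c) pre_digraph \<Rightarrow> ('b, 'd) pre_digraph \<Rightarrow> 'r::comm_ring_1 mps" where
  "hchrom G H = (let k = card (verts G); N = card (verts H) in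
     THE X. \<exists>c. hchrom_poly G H = (\<Sum>lam\<in>partitions_of k N. const (c lam) * monomial_sym {..<N} lam) \<and>
       X = (\<Sum>lam\<in>partitions_of k N. const (c lam) * msym lam))"

definition edgeless_digraph :: "nat \<Rightarrow> ('a, 'b) pre_digraph \<Rightarrow> bool" where
  "edgeless_digraph n G \<longleftrightarrow> graph G \<and> card (verts G) = n \<and> arcs G = {}"


section \<open>Well-definedness of the H-chromatic symmetric function\<close>

lemma finite_partitions_of: "finite (partitions_of k N)"
proof -
  have "partitions_of k N \<subseteq> {xs. set xs \<subseteq> {..k} \<and> length xs \<le> N}"
    by (auto simp: partitions_of_def intro: member_le_sum_list)
  then show ?thesis
    using finite_lists_length_le[of "{..k}" N] finite_subset by blast
qed

lemma int_partition_eq_iff: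
  assumes "int_partition lam" "int_partition mu"
  shows "mset lam = mset mu \<longleftrightarrow> lam = mu"
proof
  assume "mset lam = mset mu"
  then have "mset (rev lam) = mset (rev mu)" by simp
  moreover have "sorted (rev lam)" "sorted (rev mu)"
    using assms by (auto simp: int_partition_def sorted_wrt_rev)
  ultimately have "rev lam = rev mu"
    by (metis properties_for_sort)
  then show "lam = mu" by simp
qed simp

lemma size_exponents: "size (exponents M) = card (set_mset M)"
  by (simp add: exponents_def)

lemma sum_exponents: "sum_mset (exponents M) = size M"
  by (simp add: exponents_def size_multiset_overloaded_eq sum_unfold_sum_mset)

definition shape :: "nat multiset \<Rightarrow> nat list" where
  "shape M = rev (sorted_list_of_multiset (exponents M))"

lemma mset_shape [simp]: "mset (shape M) = exponents M"
  by (simp add: shape_def)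

lemma int_partition_shape: "int_partition (shape M)"
proof -
  have "\<forall>a\<in>#exponents M. 0 < a"
    by (auto simp: exponents_def)
  then show ?thesis
    by (auto simp: int_partition_def shape_def sorted_wrt_rev)
qed

lemma shape_in_partitions_of:
  assumes "set_mset M \<subseteq> {..<N}"
  shows "shape M \<in> partitions_of k N \<longleftrightarrow> size M = k"
proof -
  have "length (shape M) = card (set_mset M)"
    by (metis mset_shape size_exponents size_mset)
  moreover have "card (set_mset M) \<le> N"
    using assms card_mono[of "{..<N}"] by fastforce
  moreover have "sum_list (shape M) = size M"
    by (metis mset_shape sum_exponents sum_mset_sum_list)
  ultimately show ?thesis
    using int_partition_shape by (auto simp: partitions_of_def)
qed

lemma coeff_expansion:
  "coeff (\<Sum>lam\<in>partitions_of k N. const (c lam) * monomial_sym V lam) M =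
     (if set_mset M \<subseteq> V \<and> shape M \<in> partitions_of k N then c (shape M) else 0)"
proof -
  have "coeff (\<Sum>lam\<in>partitions_of k N. const (c lam) * monomial_sym V lam) M =
    (\<Sum>lam\<in>partitions_of k N. if lam = shape M then (if set_mset M \<subseteq> V then c lam else 0) else 0)"
    unfolding coeff_sum
  proof (rule sum.cong)
    fix lam assume "lam \<in> partitions_of k N"
    then have "exponents M = mset lam \<longleftrightarrow> lam = shape M"
      using int_partition_eq_iff[of lam "shape M"] int_partition_shape[of M]
      by (auto simp: partitions_of_def)
    then show "coeff (const (c lam) * monomial_sym V lam) M =
      (if lam = shape M then (if set_mset M \<subseteq> V then c lam else 0) else 0)"
      by (simp add: coeff_const_mult monomial_sym.rep_eq)
  qed simp
  also have "\<dots> = (if set_mset M \<subseteq> V \<and> shape M \<in> partitions_of k N then c (shape M) else 0)"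
    using finite_partitions_of[of k N] by (simp add: sum.delta)
  finally show ?thesis .
qed

lemma ex_shape:
  assumes "lam \<in> partitions_of k N"
  obtains M where "set_mset M \<subseteq> {..<N}" "shape M = lam"
proof -
  define M where "M = (\<Sum>i<length lam. replicate_mset (lam ! i) i)"
  have pos: "0 < lam ! i" if "i < length lam" for i
    using assms that by (auto simp: partitions_of_def int_partition_def)
  have cnt: "count M j = (if j < length lam then lam ! j else 0)" for j
    by (auto simp: M_def count_sum sum.delta' eq_commute)
  have set: "set_mset M = {..<length lam}"
  proof (intro equalityI subsetI)
    fix j assume "j \<in> set_mset M"
    then have "0 < count M j" by simp
    then show "j \<in> {..<length lam}" unfolding cnt by (auto split: if_splits)
  next
    fix j assume "j \<in> {..<length lam}"
    then have "0 < count M j" unfolding cnt using pos by auto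
    then show "j \<in> set_mset M" by simp
  qed
  have "exponents M = image_mset ((!) lam) (mset_set {..<length lam})"
    unfolding exponents_def set by (rule image_mset_cong) (auto simp: cnt)
  also have "\<dots> = mset (map ((!) lam) [0..<length lam])"
    by (metis atLeast_upt mset_map mset_set_upto_eq_mset_upto)
  also have "\<dots> = mset lam" by (simp add: map_nth)
  finally have "shape M = lam"
    using int_partition_eq_iff[of "shape M" lam] int_partition_shape assms
    by (auto simp: partitions_of_def)
  moreover have "set_mset M \<subseteq> {..<N}"
    using set assms by (auto simp: partitions_of_def)
  ultimately show ?thesis using that by blast
qed

lemma coeff_hchrom_poly:
  assumes "finite (verts G)" "finite (verts H)"
  shows "coeff (hchrom_poly G H :: 'r::comm_ring_1 mps) M = of_nat (card {(\<phi>, \<kappa>).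
     \<phi> \<in> labelings H \<and> \<kappa> \<in> proper_colorings G H \<phi> \<and> image_mset \<kappa> (mset_set (verts G)) = M})"
proof -
  have fin: "finite (labelings H)" "finite (proper_colorings G H \<phi>)" for \<phi>
    using assms unfolding labelings_def proper_colorings_def by (auto intro!: finite_PiE)
  have "coeff (hchrom_poly G H :: 'r mps) M = (\<Sum>\<phi>\<in>labelings H. \<Sum>\<kappa>\<in>proper_colorings G H \<phi>.
      if image_mset \<kappa> (mset_set (verts G)) = M then 1 else 0)"
    unfolding hchrom_poly_def coeff_sum prod_var[OF assms(1)] monomial.rep_eq
    by (simp add: eq_commute)
  also have "\<dots> = (\<Sum>(\<phi>, \<kappa>)\<in>Sigma (labelings H) (proper_colorings G H).
      if image_mset \<kappa> (mset_set (verts G)) = M then 1 else 0)"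
    by (rule sum.Sigma) (auto simp: fin)
  also have "\<dots> = of_nat (card (Sigma (labelings H) (proper_colorings G H) \<inter>
      {(\<phi>, \<kappa>). image_mset \<kappa> (mset_set (verts G)) = M}))"
    using fin by (subst sum.mono_neutral_cong_right[where h = "\<lambda>_. 1"
      and S = "Sigma (labelings H) (proper_colorings G H) \<inter>
        {(\<phi>, \<kappa>). image_mset \<kappa> (mset_set (verts G)) = M}"]) (auto split: if_splits)
  also have "Sigma (labelings H) (proper_colorings G H) \<inter>
      {(\<phi>, \<kappa>). image_mset \<kappa> (mset_set (verts G)) = M} =
      {(\<phi>, \<kappa>). \<phi> \<in> labelings H \<and> \<kappa> \<in> proper_colorings G H \<phi> \<and>
        image_mset \<kappa> (mset_set (verts G)) = M}"
    by auto
  finally show ?thesis .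
qed

lemma permute_labeling:
  assumes p: "p permutes {..<card (verts H)}" and \<phi>: "\<phi> \<in> labelings H"
  shows "restrict (p \<circ> \<phi>) (verts H) \<in> labelings H"
proof -
  have "bij_betw (p \<circ> \<phi>) (verts H) {..<card (verts H)}"
    using \<phi> permutes_imp_bij[OF p] by (auto simp: labelings_def intro: bij_betw_trans)
  then have "bij_betw (restrict (p \<circ> \<phi>) (verts H)) (verts H) {..<card (verts H)}"
    by (simp cong: bij_betw_cong)
  then show ?thesis
    by (auto simp: labelings_def bij_betw_def)
qed

lemma permute_coloring:
  assumes G: "graph G"
    and p: "p permutes {..<card (verts H)}" and \<phi>: "\<phi> \<in> labelings H"
    and \<kappa>: "\<kappa> \<in> proper_colorings G H \<phi>"
  shows "restrict (p \<circ> \<kappa>) (verts G) \<in> proper_colorings G H (restrict (p \<circ> \<phi>) (verts H))"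
proof -
  interpret graph G by fact
  let ?N = "card (verts H)" and ?\<psi> = "restrict (p \<circ> \<phi>) (verts H)"
  have inv: "inv_into (verts H) ?\<psi> (p j) = inv_into (verts H) \<phi> j" if j: "j < ?N" for j
  proof -
    have bij: "bij_betw \<phi> (verts H) {..<?N}" "bij_betw ?\<psi> (verts H) {..<?N}"
      using \<phi> permute_labeling[OF p \<phi>] unfolding labelings_def by blast+
    obtain x where x: "x \<in> verts H" "\<phi> x = j"
      using j bij_betw_imp_surj_on[OF bij(1)] by (metis imageE lessThan_iff)
    have "inv_into (verts H) \<phi> (\<phi> x) = x"
      using bij_betw_imp_inj_on[OF bij(1)] x(1) by (rule inv_into_f_f)
    moreover have "inv_into (verts H) ?\<psi> (?\<psi> x) = x"
      using bij_betw_imp_inj_on[OF bij(2)] x(1) by (rule inv_into_f_f)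
    ultimately show ?thesis using x by simp
  qed
  have lt: "\<kappa> v < ?N" if "v \<in> verts G" for v
    using \<kappa> that by (auto simp: proper_colorings_def)
  have plt: "p j < ?N" if "j < ?N" for j
    using permutes_in_image[OF p, of j] that by simp
  have "inv_into (verts H) ?\<psi> (restrict (p \<circ> \<kappa>) (verts G) u) \<rightarrow>\<^bsub>H\<^esub>
      inv_into (verts H) ?\<psi> (restrict (p \<circ> \<kappa>) (verts G) v)" if uv: "u \<rightarrow>\<^bsub>G\<^esub> v" for u v
  proof -
    have "u \<in> verts G" "v \<in> verts G"
      using uv by (rule adj_in_verts)+
    moreover have "inv_into (verts H) \<phi> (\<kappa> u) \<rightarrow>\<^bsub>H\<^esub> inv_into (verts H) \<phi> (\<kappa> v)"
      using \<kappa> uv by (simp add: proper_colorings_def)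
    ultimately show ?thesis
      by (simp only: restrict_apply' o_apply inv lt)
  qed
  moreover have "restrict (p \<circ> \<kappa>) (verts G) \<in> verts G \<rightarrow>\<^sub>E {..<?N}"
    by (rule restrict_PiE_iff[THEN iffD2]) (simp add: lt plt)
  ultimately show ?thesis
    by (simp only: proper_colorings_def mem_Collect_eq) blast
qed

lemma coeff_hchrom_poly_permute:
  assumes G: "graph G" and H: "graph H" and p: "p permutes {..<card (verts H)}"
  shows "coeff (hchrom_poly G H :: 'r::comm_ring_1 mps) (image_mset p M) = coeff (hchrom_poly G H) M"
proof -
  interpret G: graph G by fact
  interpret H: graph H by fact
  define S where "S M = {(\<phi>, \<kappa>). \<phi> \<in> labelings H \<and> \<kappa> \<in> proper_colorings G H \<phi> \<and>
    image_mset \<kappa> (mset_set (verts G)) = M}" for M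
  define act where "act q = (\<lambda>(\<phi>, \<kappa>). (restrict (q \<circ> \<phi>) (verts H), restrict (q \<circ> \<kappa>) (verts G)))"
    for q :: "nat \<Rightarrow> nat"
  have maps: "act q x \<in> S (image_mset q M)"
    if q: "q permutes {..<card (verts H)}" and x: "x \<in> S M" for q x M
  proof -
    obtain \<phi> \<kappa> where [simp]: "x = (\<phi>, \<kappa>)" by force
    have "image_mset (restrict (q \<circ> \<kappa>) (verts G)) (mset_set (verts G)) =
        image_mset (q \<circ> \<kappa>) (mset_set (verts G))"
      by (rule image_mset_cong) simp
    also have "\<dots> = image_mset q M"
      using x by (auto simp: S_def multiset.map_comp[symmetric])
    finally show ?thesis
      using x permute_labeling[OF q] permute_coloring[OF G q]
      by (auto simp: S_def act_def)
  qed
  have cancel: "act r (act q x) = x" if "\<And>j. r (q j) = j" "x \<in> S M" for r q x M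
  proof -
    obtain \<phi> \<kappa> where [simp]: "x = (\<phi>, \<kappa>)" by force
    have "\<phi> \<in> extensional (verts H)" "\<kappa> \<in> extensional (verts G)"
      using that(2) by (auto simp: S_def labelings_def proper_colorings_def PiE_def)
    then show ?thesis
      using that(1) by (auto simp: act_def fun_eq_iff restrict_def extensional_def)
  qed
  note p' = permutes_inv[OF p]
  have inv: "inv p (p j) = j" "p (inv p j) = j" for j
    using permutes_inverses[OF p] by auto
  have "image_mset (inv p) (image_mset p M) = M"
    by (simp add: multiset.map_comp o_def inv)
  then have "bij_betw (act p) (S M) (S (image_mset p M))"
    using maps[OF p, of _ M] maps[OF p', of _ "image_mset p M"]
    by (intro bij_betw_byWitness[where f' = "act (inv p)"])
      (auto simp: cancel[of "inv p" p] cancel[of p "inv p"] inv)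
  then have "card (S (image_mset p M)) = card (S M)"
    by (metis bij_betw_same_card)
  then show ?thesis
    by (simp add: coeff_hchrom_poly S_def)
qed

lemma count_image_mset_inj: "inj f \<Longrightarrow> count (image_mset f M) (f x) = count M x"
  by (induction M) (auto simp: inj_eq)

lemma exponents_eq_permute:
  assumes "set_mset M \<subseteq> {..<N}" "set_mset M' \<subseteq> {..<N}" "exponents M = exponents M'"
  obtains p where "p permutes {..<N}" "M = image_mset p M'"
proof -
  have split: "image_mset (count A) (mset_set {..<N}) =
      exponents A + replicate_mset (N - size (exponents A)) 0"
    if "set_mset A \<subseteq> {..<N}" for A
  proof -
    have fin: "finite ({..<N} - set_mset A)" by simp
    have "{..<N} = set_mset A \<union> ({..<N} - set_mset A)" using that by auto
    then have "mset_set {..<N} = mset_set (set_mset A) + mset_set ({..<N} - set_mset A)"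
      by (metis Diff_disjoint fin finite_set_mset mset_set_Union)
    moreover have "image_mset (count A) (mset_set ({..<N} - set_mset A)) =
        image_mset (\<lambda>_. 0) (mset_set ({..<N} - set_mset A))"
      by (rule image_mset_cong) (auto simp: not_in_iff)
    moreover have "card ({..<N} - set_mset A) = N - size (exponents A)"
      using that by (simp add: card_Diff_subset size_exponents)
    ultimately show ?thesis
      by (simp add: exponents_def image_mset_const_eq)
  qed
  have "image_mset (count M') (mset_set {..<N}) = image_mset (count M) (mset_set {..<N})"
    using split[OF assms(1)] split[OF assms(2)] assms(3) by simp
  then obtain p where p: "p permutes {..<N}" "\<And>x. x \<in> {..<N} \<Longrightarrow> count M' x = count M (p x)"
    using image_mset_eq_implies_permutes[of "{..<N}" "count M'" "count M"]
    by (metis finite_lessThan)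
  have "count M (p x) = count M' x" for x
  proof (cases "x < N")
    case False
    then have "p x = x" using p(1) by (simp add: permutes_not_in)
    with False show ?thesis using assms(1,2) by (metis count_inI lessThan_iff subsetD)
  qed (use p(2) in auto)
  then have "count M y = count (image_mset p M') y" for y
    using permutes_inverses(1)[OF p(1)] count_image_mset_inj[OF permutes_inj[OF p(1)]] by metis
  then show ?thesis using p(1) that multiset_eqI by blast
qed

theorem hchrom_expansion_ex1:
  fixes G :: "('a, 'c) pre_digraph" and H :: "('b, 'd) pre_digraph"
  assumes G: "graph G" and H: "graph H"
  defines "k \<equiv> card (verts G)" and "N \<equiv> card (verts H)"
  shows "\<exists>!X. \<exists>c. (hchrom_poly G H :: 'r::comm_ring_1 mps) =
      (\<Sum>lam\<in>partitions_of k N. const (c lam) * monomial_sym {..<N} lam) \<and>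
      X = (\<Sum>lam\<in>partitions_of k N. const (c lam) * msym lam)"
proof -
  interpret G: graph G by fact
  interpret H: graph H by fact
  let ?w = "hchrom_poly G H :: 'r mps"
  define rep where "rep lam = (SOME M. set_mset M \<subseteq> {..<N} \<and> shape M = lam)" for lam
  have supp: "coeff ?w M = 0" if "\<not> (set_mset M \<subseteq> {..<N} \<and> size M = k)" for M
  proof -
    have "{(\<phi>, \<kappa>). \<phi> \<in> labelings H \<and> \<kappa> \<in> proper_colorings G H \<phi> \<and>
        image_mset \<kappa> (mset_set (verts G)) = M} = {}"
      using that by (auto simp: proper_colorings_def N_def k_def)
    then have "card {(\<phi>, \<kappa>). \<phi> \<in> labelings H \<and> \<kappa> \<in> proper_colorings G H \<phi> \<and>
        image_mset \<kappa> (mset_set (verts G)) = M} = 0"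
      by (metis card.empty)
    then show ?thesis by (simp add: coeff_hchrom_poly)
  qed
  have "?w = (\<Sum>lam\<in>partitions_of k N. const (coeff ?w (rep lam)) * monomial_sym {..<N} lam)"
  proof (rule mps_eqI)
    fix M :: "nat multiset"
    have "coeff ?w M = coeff ?w (rep (shape M))" if M: "set_mset M \<subseteq> {..<N}"
    proof -
      have "set_mset (rep (shape M)) \<subseteq> {..<N} \<and> shape (rep (shape M)) = shape M"
        unfolding rep_def by (rule someI[of _ M]) (use M in simp)
      moreover from this have "exponents M = exponents (rep (shape M))"
        by (metis mset_shape)
      ultimately obtain p where "p permutes {..<N}" "M = image_mset p (rep (shape M))"
        using exponents_eq_permute M by blast
      then show ?thesis
        using coeff_hchrom_poly_permute[OF G H] by (metis N_def)
    qed
    then show "coeff ?w M = coeff (\<Sum>lam\<in>partitions_of k N.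
        const (coeff ?w (rep lam)) * monomial_sym {..<N} lam) M"
      unfolding coeff_expansion using supp[of M] shape_in_partitions_of[of M N k] by auto
  qed
  note ex = this
  have uniq: "c lam = d lam" if
    eq: "(\<Sum>lam\<in>partitions_of k N. const (c lam) * monomial_sym {..<N} lam) =
      (\<Sum>lam\<in>partitions_of k N. const (d lam :: 'r) * monomial_sym {..<N} lam)"
    and lam: "lam \<in> partitions_of k N" for c d lam
  proof -
    obtain M where "set_mset M \<subseteq> {..<N}" "shape M = lam"
      using ex_shape[OF lam] .
    with arg_cong[OF eq, of "\<lambda>f. coeff f M"] lam show ?thesis
      by (simp add: coeff_expansion)
  qed
  show ?thesis
  proof (rule ex_ex1I)
    fix X Y :: "'r mps"
    assume "\<exists>c. ?w = (\<Sum>lam\<in>partitions_of k N. const (c lam) * monomial_sym {..<N} lam) \<and>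
      X = (\<Sum>lam\<in>partitions_of k N. const (c lam) * msym lam)"
    then obtain c where c: "?w = (\<Sum>lam\<in>partitions_of k N. const (c lam) * monomial_sym {..<N} lam)"
      "X = (\<Sum>lam\<in>partitions_of k N. const (c lam) * msym lam)" by blast
    assume "\<exists>c. ?w = (\<Sum>lam\<in>partitions_of k N. const (c lam) * monomial_sym {..<N} lam) \<and>
      Y = (\<Sum>lam\<in>partitions_of k N. const (c lam) * msym lam)"
    then obtain d where d: "?w = (\<Sum>lam\<in>partitions_of k N. const (d lam) * monomial_sym {..<N} lam)"
      "Y = (\<Sum>lam\<in>partitions_of k N. const (d lam) * msym lam)" by blast
    have "c lam = d lam" if "lam \<in> partitions_of k N" for lam
      using uniq[OF _ that] c(1) d(1) by metis
    then show "X = Y" unfolding c(2) d(2) by (intro sum.cong) auto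
  qed (rule exI, rule exI, rule conjI, rule ex, rule refl)
qed

end

theory Submission
  imports Defs
begin

text \<open>
  With a single color available, an edgeless graph on \<open>n\<close> vertices has exactly one coloring, so
  \<open>w\<close> is the single monomial $x_1^n = m_{(n)}(x_1)$, and its lift to countably many
  variables is $p_n$.
\<close>

text \<open>\<open>hchrom\<close> is a definite description, and \<open>hchrom_expansion_ex1\<close>
  makes it unique, so exhibiting one coefficient function \<open>c\<close> suffices.\<close>

lemma hchrom_eqI:
  fixes c :: "nat list \<Rightarrow> 'r::comm_ring_1"
  assumes "graph G" and "graph H"
    and "hchrom_poly G H = (\<Sum>lam\<in>partitions_of (card (verts G)) (card (verts H)).
      const (c lam) * monomial_sym {..<card (verts H)} lam)"
  shows "hchrom G H = (\<Sum>lam\<in>partitions_of (card (verts G)) (card (verts H)). const (c lam) * msym lam)"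
  unfolding hchrom_def Let_def
  by (rule the1_equality[OF hchrom_expansion_ex1[OF assms(1,2)]]) (use assms(3) in blast)

lemma const_1_mult [simp]: "const 1 * f = f"
  by (rule mps_eqI) (simp add: coeff_const_mult)

text \<open>Positivity matters: for \<open>n = 0\<close> the only partition is the empty
  list.\<close>

lemma partitions_of_1: "0 < n \<Longrightarrow> partitions_of n 1 = {[n]}"
  by (auto simp: partitions_of_def int_partition_def le_Suc_eq length_Suc_conv)

lemma monomial_sym_single_variable:
  assumes "0 < n"
  shows "monomial_sym {..<1} [n] = (monomial (replicate_mset n 0) :: 'r::comm_ring_1 mps)"
proof (rule mps_eqI)
  fix M
  have "set_mset M \<subseteq> {..<1} \<and> exponents M = mset [n] \<longleftrightarrow> M = replicate_mset n 0"
  proof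
    assume M: "set_mset M \<subseteq> {..<1} \<and> exponents M = mset [n]"
    \<comment> \<open>The exponents of \<open>M\<close> sum to its size; with index 0 as the only
      possible variable, the size determines \<open>M\<close>.\<close>
    then have "size M = n"
      using sum_exponents[of M] by simp
    moreover have "set_mset M \<subseteq> {0}"
      using M by auto
    ultimately show "M = replicate_mset n 0"
      by (metis set_mset_subset_singletonD)
  qed (use assms in \<open>auto simp: exponents_def\<close>)
  then show "coeff (monomial_sym {..<1} [n]) M = (coeff (monomial (replicate_mset n 0)) M :: 'r)"
    by (simp add: monomial_sym.rep_eq monomial.rep_eq)
qed

lemma labelings_single_vertex:
  assumes "verts H = {v}"
  shows "labelings H = {\<lambda>x\<in>{v}. 0}"
proof -
  have "{..<Suc 0} = {0}"
    by auto
  then have "labelings H = {\<phi> \<in> {\<lambda>x\<in>{v}. 0}. bij_betw \<phi> {v} {0}}"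
    by (simp add: labelings_def assms PiE_over_singleton_iff restrict_def)
  also have "\<dots> = {\<lambda>x\<in>{v}. 0}"
    by (auto simp: bij_betw_def)
  finally show ?thesis .
qed

lemma hchrom_poly_edgeless_single_vertex:
  assumes "finite (verts G)" and "arcs G = {}" and "card (verts H) = 1"
  shows "hchrom_poly G H = (monomial (replicate_mset (card (verts G)) 0) :: 'r::comm_ring_1 mps)"
proof -
  obtain v where v: "verts H = {v}"
    using assms(3) card_1_singletonE by blast
  \<comment> \<open>Rewrites the color set as a singleton, so that
    \<open>PiE_over_singleton_iff\<close> applies.\<close>
  have "{..<Suc 0} = {0}"
    by auto
  \<comment> \<open>Without arcs the adjacency condition is vacuous, so the colorings do not depend
    on the labeling.\<close>
  then have "proper_colorings G H \<phi> = verts G \<rightarrow>\<^sub>E {0}" for \<phi>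
    using assms(2) by (simp add: proper_colorings_def v arcs_ends_def)
  then have "proper_colorings G H \<phi> = {\<lambda>u\<in>verts G. 0}" for \<phi>
    by (simp add: PiE_over_singleton_iff restrict_def)
  then have "hchrom_poly G H = (\<Prod>u\<in>verts G. var ((\<lambda>u\<in>verts G. 0) u) :: 'r mps)"
    by (simp add: hchrom_poly_def labelings_single_vertex[OF v])
  also have "\<dots> = (\<Prod>u\<in>verts G. var 0)"
    by (rule prod.cong) auto
  also have "\<dots> = monomial (replicate_mset (card (verts G)) 0)"
    using assms(1) by (simp only: prod_var image_mset_const_eq size_mset_set)
  finally show ?thesis .
qed

text \<open>The case \<open>n = 0\<close> must be excluded: \<open>power_sum 0\<close> is 0, since
  no monomial has a zero among its \<open>exponents\<close>, while the graph without vertices gives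
  1.\<close>

lemma hchrom_edgeless_complete_1:
  assumes "edgeless_digraph n G" and "complete_digraph 1 H" and "0 < n"
  shows "hchrom G H = (power_sum n :: 'r::comm_ring_1 mps)"
proof -
  have G: "graph G" "card (verts G) = n" "arcs G = {}"
    using assms(1) by (auto simp: edgeless_digraph_def)
  have H: "graph H" "card (verts H) = 1"
    using assms(2) by (auto simp: complete_digraph_def)
  interpret G: graph G by fact
  have "hchrom_poly G H = (monomial_sym {..<1} [n] :: 'r mps)"
    using hchrom_poly_edgeless_single_vertex[OF _ G(3) H(2)] assms(3) G(2)
    by (simp add: monomial_sym_single_variable[simplified])
  \<comment> \<open>\<open>[n]\<close> alone indexes the expansion, so the constant coefficient 1
    describes it.\<close>
  then show ?thesis
    using hchrom_eqI[OF G(1) H(1), of "\<lambda>_. 1 :: 'r"] partitions_of_1[OF assms(3)] G(2) H(2)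
    by (simp add: power_sum_def)
qed

theorem corollary7p7:
  fixes lam :: "nat list"
    and K1 :: "('a, 'b) pre_digraph"
    and E :: "nat \<Rightarrow> ('c, 'd) pre_digraph"
  assumes "int_partition lam"
    and "complete_digraph 1 K1"
    and "\<And>i. i < length lam \<Longrightarrow> edgeless_digraph (lam ! i) (E i)"
  shows "(power_sum_partition lam :: 'r::comm_ring_1 mps) = (\<Prod>i<length lam. hchrom (E i) K1)"
  unfolding power_sum_partition_def
proof (rule prod.cong)
  fix i assume "i \<in> {..<length lam}"
  then show "power_sum (lam ! i) = (hchrom (E i) K1 :: 'r mps)"
    \<comment> \<open>Parts of a partition are positive, which discharges
      \<open>0 < lam ! i\<close>.\<close>
    using assms by (intro hchrom_edgeless_complete_1[symmetric]) (auto simp: int_partition_def)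
qed simp

end
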